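(* Let $G$ be a group with commutator subgroup $G'$. If $H_1(G):=G/G'$ is infinite, then $G$ is unbounded.
   Context: A conjugation-invariant norm on a group $G$ is a function $\nu:G\to[0,+\infty)$ such that $\nu(1)=0$; $\nu(f)=\nu(f^{-1})$; $\nu(fg)\le\nu(f)+\nu(g)$; $\nu(gfg^{-1})=\nu(f)$ for all $f,g\in G$; and $\nu(f)>0$ for all $f\ne1$. A group is bounded if it has finite diameter with respect to every bi-invariant metric, equivalently if every conjugation-invariant norm on it is a bounded function; it is unbounded otherwise. *)

theory Defs
  imports "HOL-Algebra.Algebra" "HOL-Analysis.Abstract_Metric_Spaces"
begin

text \<open>Norms and metrics are total functions on the underlying type; their axioms are relativised
  to the carrier. The exceptions are nonnegativity and symmetry in \<^locale>\<open>Metric_space\<close>,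
  which hold everywhere; every metric on the carrier extends by \<open>0\<close> to satisfy them.\<close>

definition conj_invariant_norm :: "('a, 'b) monoid_scheme \<Rightarrow> ('a \<Rightarrow> real) \<Rightarrow> bool" where
  "conj_invariant_norm G \<nu> \<longleftrightarrow>
     (\<forall>f\<in>carrier G. 0 \<le> \<nu> f) \<and>
     \<nu> \<one>\<^bsub>G\<^esub> = 0 \<and>
     (\<forall>f\<in>carrier G. \<nu> f = \<nu> (inv\<^bsub>G\<^esub> f)) \<and>
     (\<forall>f\<in>carrier G. \<forall>g\<in>carrier G. \<nu> (f \<otimes>\<^bsub>G\<^esub> g) \<le> \<nu> f + \<nu> g) \<and>
     (\<forall>f\<in>carrier G. \<forall>g\<in>carrier G. \<nu> (g \<otimes>\<^bsub>G\<^esub> f \<otimes>\<^bsub>G\<^esub> inv\<^bsub>G\<^esub> g) = \<nu> f) \<and>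
     (\<forall>f\<in>carrier G. f \<noteq> \<one>\<^bsub>G\<^esub> \<longrightarrow> 0 < \<nu> f)"

definition bi_invariant_metric :: "('a, 'b) monoid_scheme \<Rightarrow> ('a \<Rightarrow> 'a \<Rightarrow> real) \<Rightarrow> bool" where
  "bi_invariant_metric G d \<longleftrightarrow>
     Metric_space (carrier G) d \<and>
     (\<forall>h\<in>carrier G. \<forall>x\<in>carrier G. \<forall>y\<in>carrier G.
        d (h \<otimes>\<^bsub>G\<^esub> x) (h \<otimes>\<^bsub>G\<^esub> y) = d x y \<and> d (x \<otimes>\<^bsub>G\<^esub> h) (y \<otimes>\<^bsub>G\<^esub> h) = d x y)"

definition bounded_group :: "('a, 'b) monoid_scheme \<Rightarrow> bool" where
  "bounded_group G \<longleftrightarrow>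
     (\<forall>d. bi_invariant_metric G d \<longrightarrow> (\<exists>C. \<forall>x\<in>carrier G. \<forall>y\<in>carrier G. d x y \<le> C))"

definition unbounded_group :: "('a, 'b) monoid_scheme \<Rightarrow> bool" where
  "unbounded_group G \<longleftrightarrow> \<not> bounded_group G"

lemma (in group) conj_invariant_norm_imp_metric:
  assumes "conj_invariant_norm G \<nu>"
  shows "bi_invariant_metric G
           (\<lambda>x y. if x \<in> carrier G \<and> y \<in> carrier G then \<nu> (inv x \<otimes> y) else 0)"
    (is "bi_invariant_metric G ?d")
proof -
  have nn: "0 \<le> \<nu> f" and iv: "\<nu> (inv f) = \<nu> f" and pos: "f \<noteq> \<one> \<Longrightarrow> 0 < \<nu> f"
    if "f \<in> carrier G" for f
    using assms that unfolding conj_invariant_norm_def by metis+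
  have one: "\<nu> \<one> = 0"
    using assms unfolding conj_invariant_norm_def by blast
  have tri: "\<nu> (f \<otimes> g) \<le> \<nu> f + \<nu> g" and cj: "\<nu> (g \<otimes> f \<otimes> inv g) = \<nu> f"
    if "f \<in> carrier G" "g \<in> carrier G" for f g
    using assms that unfolding conj_invariant_norm_def by metis+
  have "Metric_space (carrier G) ?d"
  proof
    show "0 \<le> ?d x y" for x y
      by (simp add: nn)
    show "?d x y = ?d y x" for x y
      using iv[of "inv x \<otimes> y"] by (auto simp: inv_mult_group)
    show "?d x y = 0 \<longleftrightarrow> x = y" if "x \<in> carrier G" "y \<in> carrier G" for x y
    proof
      assume "?d x y = 0"
      then have "inv x \<otimes> y = \<one>"
        using pos[of "inv x \<otimes> y"] that by force
      then show "x = y"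
        using that inv_equality[of "inv x" y] inv_inv by (metis inv_closed)
    qed (use that one in simp)
    show "?d x z \<le> ?d x y + ?d y z"
      if "x \<in> carrier G" "y \<in> carrier G" "z \<in> carrier G" for x y z
    proof -
      have "y \<otimes> (inv y \<otimes> z) = z"
        using that by (simp add: m_assoc[symmetric])
      then have "inv x \<otimes> z = (inv x \<otimes> y) \<otimes> (inv y \<otimes> z)"
        using that by (simp add: m_assoc)
      then show ?thesis
        using tri[of "inv x \<otimes> y" "inv y \<otimes> z"] that by simp
    qed
  qed
  moreover have "?d (h \<otimes> x) (h \<otimes> y) = ?d x y \<and> ?d (x \<otimes> h) (y \<otimes> h) = ?d x y"
    if "h \<in> carrier G" "x \<in> carrier G" "y \<in> carrier G" for h x y
  proof -
    have "inv h \<otimes> (h \<otimes> y) = y"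
      using that by (simp add: m_assoc[symmetric])
    then have "inv (h \<otimes> x) \<otimes> (h \<otimes> y) = inv x \<otimes> y"
      using that by (simp add: inv_mult_group m_assoc)
    moreover have "inv (x \<otimes> h) \<otimes> (y \<otimes> h) = inv h \<otimes> (inv x \<otimes> y) \<otimes> inv (inv h)"
      using that by (simp add: inv_mult_group m_assoc)
    ultimately show ?thesis
      using that cj[of "inv x \<otimes> y" "inv h"] by simp
  qed
  ultimately show ?thesis
    by (simp add: bi_invariant_metric_def)
qed

lemma (in group) bi_invariant_metric_imp_norm:
  assumes "bi_invariant_metric G d"
  shows "conj_invariant_norm G (d \<one>)"
proof -
  interpret M: Metric_space "carrier G" d
    using assms by (simp add: bi_invariant_metric_def)
  have L: "d (h \<otimes> x) (h \<otimes> y) = d x y" and R: "d (x \<otimes> h) (y \<otimes> h) = d x y"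
    if "h \<in> carrier G" "x \<in> carrier G" "y \<in> carrier G" for h x y
    using assms that by (auto simp: bi_invariant_metric_def)
  have "d \<one> (inv f) = d \<one> f" if "f \<in> carrier G" for f
    using L[of f \<one> "inv f"] M.commute[of f \<one>] that by simp
  moreover have "d \<one> (f \<otimes> g) \<le> d \<one> f + d \<one> g" if "f \<in> carrier G" "g \<in> carrier G" for f g
    using M.triangle[of \<one> f "f \<otimes> g"] L[of f \<one> g] that by simp
  moreover have "d \<one> (g \<otimes> f \<otimes> inv g) = d \<one> f" if "f \<in> carrier G" "g \<in> carrier G" for f g
    using R[of "inv g" g "g \<otimes> f"] L[of g \<one> f] that by (simp add: m_assoc)
  moreover have "0 < d \<one> f" if "f \<in> carrier G" "f \<noteq> \<one>" for f
    using that M.mdist_pos_eq by auto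
  ultimately show ?thesis
    by (auto simp: conj_invariant_norm_def)
qed

lemma (in group) bounded_group_iff_norm:
  "bounded_group G \<longleftrightarrow>
     (\<forall>\<nu>. conj_invariant_norm G \<nu> \<longrightarrow> (\<exists>C. \<forall>f\<in>carrier G. \<nu> f \<le> C))"
proof (intro iffI allI impI)
  fix \<nu> assume b: "bounded_group G" and n: "conj_invariant_norm G \<nu>"
  obtain C where "\<And>x y. \<lbrakk>x \<in> carrier G; y \<in> carrier G\<rbrakk> \<Longrightarrow> \<nu> (inv x \<otimes> y) \<le> C"
    using b conj_invariant_norm_imp_metric[OF n] unfolding bounded_group_def by fastforce
  from this[OF one_closed] show "\<exists>C. \<forall>f\<in>carrier G. \<nu> f \<le> C"
    by auto
next
  assume n: "\<forall>\<nu>. conj_invariant_norm G \<nu> \<longrightarrow> (\<exists>C. \<forall>f\<in>carrier G. \<nu> f \<le> C)"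
  have "\<exists>C. \<forall>x\<in>carrier G. \<forall>y\<in>carrier G. d x y \<le> C" if d: "bi_invariant_metric G d" for d
  proof -
    obtain C where C: "\<forall>f\<in>carrier G. d \<one> f \<le> C"
      using n bi_invariant_metric_imp_norm[OF d] by blast
    have "d x y \<le> C" if "x \<in> carrier G" "y \<in> carrier G" for x y
    proof -
      have "d (inv x \<otimes> x) (inv x \<otimes> y) = d x y"
        using d that unfolding bi_invariant_metric_def by (metis inv_closed)
      then show ?thesis
        using C that by (metis inv_closed l_inv m_closed)
    qed
    then show ?thesis by blast
  qed
  then show "bounded_group G"
    by (simp add: bounded_group_def)
qed

end

theory Submission
  imports Defs "HOL-Number_Theory.Cong"
begin

text \<open>
  A group is unbounded as soon as it is the union of sets \<open>S 0 \<subseteq> S 1 \<subseteq> \<dots>\<close>, each one proper and closed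
  under inversion and conjugation, such that \<open>S n\<close> times \<open>S n\<close> lies in \<open>S (n + 1)\<close>: up to a shift
  by \<open>1\<close>, the first index at which an element appears is a conjugation-invariant norm
  (\<open>unbounded_group_if_filtration\<close>).

  Such a filtration is easy to find when \<open>G\<close> maps onto a countably infinite abelian group \<open>Q\<close>. List the
  elements of \<open>Q\<close> and let \<open>F (n + 1)\<close> consist of the products of pairs from \<open>F n\<close>, together with the
  \<open>n\<close>-th element of the list and its inverse. The sets \<open>F n\<close> are finite, hence proper, and they
  exhaust \<open>Q\<close>. Their preimages in \<open>G\<close> are conjugation-invariant because \<open>Q\<close> is abelian.

  It remains to see that every infinite abelian group \<open>A\<close>, here \<open>G/G'\<close>, has a countably infinite
  quotient. Take a countably infinite subgroup \<open>B\<close> and, by Zorn's lemma, a subgroup \<open>K\<close> that is maximal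
  among those meeting \<open>B\<close> trivially. Then \<open>B\<close> embeds into \<open>A/K\<close>, so the quotient is infinite, and by
  maximality every nontrivial element of \<open>A/K\<close> has a nontrivial power in the image of \<open>B\<close>. An abelian
  group with this property is countable: its elements of prime order lie in \<open>B\<close>, so for each
  \<open>n > 0\<close> it has countably many elements killed by \<open>n\<close>, so each element of \<open>B\<close> has countably many
  \<open>n\<close>-th roots, and every element of the group is such a root for some \<open>n\<close>.
\<close>

section \<open>Unboundedness from a filtration\<close>

text \<open>
  Write \<open>L x\<close> for the least \<open>n\<close> with \<open>x \<in> S n\<close>. The product condition gives
  \<open>L (x y) \<le> max (L x) (L y) + 1\<close>, which becomes the triangle inequality after adding \<open>1\<close> to \<open>L\<close> off the
  identity; the same shift makes the function positive there. A bound on it would put the whole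
  group into a single \<open>S n\<close>.
\<close>

lemma (in group) unbounded_group_if_filtration:
  fixes S :: "nat \<Rightarrow> 'a set"
  assumes mono: "\<And>n. S n \<subseteq> S (Suc n)"
    and cover: "carrier G \<subseteq> (\<Union>n. S n)"
    and proper: "\<And>n. \<not> carrier G \<subseteq> S n"
    and inv_mem: "\<And>n x. \<lbrakk>x \<in> carrier G; x \<in> S n\<rbrakk> \<Longrightarrow> inv x \<in> S n"
    and mult_mem: "\<And>n x y. \<lbrakk>x \<in> carrier G; y \<in> carrier G; x \<in> S n; y \<in> S n\<rbrakk> \<Longrightarrow> x \<otimes> y \<in> S (Suc n)"
    and conj_mem: "\<And>n x g. \<lbrakk>x \<in> carrier G; g \<in> carrier G; x \<in> S n\<rbrakk> \<Longrightarrow> g \<otimes> x \<otimes> inv g \<in> S n"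
  shows "unbounded_group G"
proof -
  define L where "L x = (LEAST n. x \<in> S n)" for x
  define \<nu> where "\<nu> x = (if x = \<one> then 0 else 1 + real (L x))" for x
  have S_L: "x \<in> S (L x)" if "x \<in> carrier G" for x
    unfolding L_def using that cover by (auto intro: LeastI)
  have L_le: "L x \<le> n" if "x \<in> S n" for x n
    unfolding L_def using that by (rule Least_le)
  have S_le: "S m \<subseteq> S n" if "m \<le> n" for m n
    using mono that by (rule lift_Suc_mono_le)
  have L_inv: "L (inv x) \<le> L x" if "x \<in> carrier G" for x
    using L_le inv_mem S_L that by blast
  have L_conj: "L (g \<otimes> x \<otimes> inv g) \<le> L x" if "x \<in> carrier G" "g \<in> carrier G" for x g
    using L_le conj_mem S_L that by blast
  have L_mult: "L (x \<otimes> y) \<le> Suc (max (L x) (L y))" if "x \<in> carrier G" "y \<in> carrier G" for x y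
    using S_L S_le that by (intro L_le mult_mem) (blast intro: max.cobounded1 max.cobounded2)+
  have \<nu>_inv: "\<nu> x = \<nu> (inv x)" if x: "x \<in> carrier G" for x
    using L_inv[OF x] L_inv[of "inv x"] x by (auto simp: \<nu>_def)
  have \<nu>_conj: "\<nu> (g \<otimes> x \<otimes> inv g) = \<nu> x" if xg: "x \<in> carrier G" "g \<in> carrier G" for x g
  proof -
    have conj_back: "inv g \<otimes> (g \<otimes> x \<otimes> inv g) \<otimes> inv (inv g) = x"
      using xg by (simp add: m_assoc inv_solve_left')
    have "L (g \<otimes> x \<otimes> inv g) = L x"
      using L_conj[OF xg] L_conj[of "g \<otimes> x \<otimes> inv g" "inv g"] xg unfolding conj_back by simp
    moreover have "g \<otimes> x \<otimes> inv g = \<one> \<longleftrightarrow> x = \<one>"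
      using conj_back xg by auto
    ultimately show ?thesis by (simp add: \<nu>_def)
  qed
  have \<nu>_mult: "\<nu> (x \<otimes> y) \<le> \<nu> x + \<nu> y" if xy: "x \<in> carrier G" "y \<in> carrier G" for x y
    using L_mult[OF xy] xy by (auto simp: \<nu>_def)
  have norm: "conj_invariant_norm G \<nu>"
    unfolding conj_invariant_norm_def using \<nu>_inv \<nu>_mult \<nu>_conj
    by (intro conjI ballI) (auto simp: \<nu>_def)
  have "\<not> (\<forall>f\<in>carrier G. \<nu> f \<le> C)" for C
  proof
    assume C: "\<forall>f\<in>carrier G. \<nu> f \<le> C"
    \<comment> \<open>The norm does not control \<open>L\<close> at the identity, so that value enters the bound separately.\<close>
    define m where "m = max (L \<one>) (nat \<lceil>C\<rceil>)"
    have "x \<in> S m" if x: "x \<in> carrier G" for x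
    proof -
      have "L x \<le> m"
      proof (cases "x = \<one>")
        case False
        then have "real (L x) \<le> C" using C x by (force simp: \<nu>_def)
        then show ?thesis unfolding m_def by linarith
      qed (simp add: m_def)
      then show ?thesis using S_L S_le x by blast
    qed
    then show False using proper by blast
  qed
  with norm show ?thesis
    unfolding unbounded_group_def bounded_group_iff_norm by blast
qed

section \<open>Finite doubling sets\<close>

text \<open>
  A substitute for the balls of radius \<open>2 ^ n\<close> in a word norm: squaring the previous set gives the
  weak triangle inequality, while adding the letters one at a time keeps every set finite even
  if infinitely many letters are needed.
\<close>

primrec doubling_sets :: "('a, 'b) monoid_scheme \<Rightarrow> (nat \<Rightarrow> 'a) \<Rightarrow> nat \<Rightarrow> 'a set" where
  "doubling_sets G e 0 = {\<one>\<^bsub>G\<^esub>}"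
| "doubling_sets G e (Suc n) =
     (doubling_sets G e n <#>\<^bsub>G\<^esub> doubling_sets G e n) \<union> {e n, inv\<^bsub>G\<^esub> e n}"

context group
begin

lemma doubling_sets_mult:
  "x \<in> doubling_sets G e n \<Longrightarrow> y \<in> doubling_sets G e n \<Longrightarrow> x \<otimes> y \<in> doubling_sets G e (Suc n)"
  by (auto simp: set_mult_def)

lemma finite_doubling_sets: "finite (doubling_sets G e n)"
  by (induction n) (auto simp: set_mult_def)

context
  fixes e :: "nat \<Rightarrow> 'a"
  assumes e_closed: "range e \<subseteq> carrier G"
begin

lemma doubling_sets_subset: "doubling_sets G e n \<subseteq> carrier G"
proof (induction n)
  case (Suc n)
  have "e n \<in> carrier G" using e_closed by blast
  then show ?case using set_mult_closed[OF Suc.IH Suc.IH] by simp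
qed simp

lemma one_in_doubling_sets: "\<one> \<in> doubling_sets G e n"
proof (induction n)
  case (Suc n)
  then show ?case using doubling_sets_mult[of \<one> e n \<one>] by simp
qed simp

lemma doubling_sets_Suc: "doubling_sets G e n \<subseteq> doubling_sets G e (Suc n)"
proof
  fix x assume x: "x \<in> doubling_sets G e n"
  then have "x \<otimes> \<one> \<in> doubling_sets G e (Suc n)"
    using doubling_sets_mult one_in_doubling_sets by blast
  then show "x \<in> doubling_sets G e (Suc n)"
    using x doubling_sets_subset by (metis r_one subsetD)
qed

lemma doubling_sets_inv:
  "x \<in> doubling_sets G e n \<Longrightarrow> inv x \<in> doubling_sets G e n"
proof (induction n arbitrary: x)
  case (Suc n)
  from Suc.prems consider
      a b where "a \<in> doubling_sets G e n" "b \<in> doubling_sets G e n" "x = a \<otimes> b"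
    | "x = e n" | "x = inv e n"
    by (auto simp: set_mult_def)
  then show ?case
  proof cases
    case 1
    then have "a \<in> carrier G" "b \<in> carrier G" using doubling_sets_subset by blast+
    then have "inv x = inv b \<otimes> inv a" using 1 by (simp add: inv_mult_group)
    then show ?thesis using Suc.IH 1 doubling_sets_mult by metis
  next
    case 3
    then have "inv x = e n" using e_closed by (simp add: range_subsetD)
    then show ?thesis by simp
  qed simp
qed simp

lemma range_subset_Union_doubling_sets: "range e \<subseteq> (\<Union>n. doubling_sets G e n)"
proof
  fix x assume "x \<in> range e"
  then obtain n where "x = e n" by blast
  then have "x \<in> doubling_sets G e (Suc n)" by simp
  then show "x \<in> (\<Union>n. doubling_sets G e n)" by blast
qed

lemma subgroup_Union_doubling_sets: "subgroup (\<Union>n. doubling_sets G e n) G"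
proof (rule subgroupI)
  fix x y assume "x \<in> (\<Union>n. doubling_sets G e n)" "y \<in> (\<Union>n. doubling_sets G e n)"
  then obtain m n where "x \<in> doubling_sets G e m" "y \<in> doubling_sets G e n" by blast
  moreover have "doubling_sets G e i \<subseteq> doubling_sets G e (max m n)" if "i \<le> max m n" for i
    using doubling_sets_Suc that by (rule lift_Suc_mono_le)
  ultimately have "x \<otimes> y \<in> doubling_sets G e (Suc (max m n))"
    by (meson doubling_sets_mult max.cobounded1 max.cobounded2 subsetD)
  then show "x \<otimes> y \<in> (\<Union>n. doubling_sets G e n)" by blast
next
  show "(\<Union>n. doubling_sets G e n) \<noteq> {}" using one_in_doubling_sets by blast
qed (use doubling_sets_subset doubling_sets_inv in blast)+

end

text \<open>
  The doubling sets of an injective sequence are finite, so their union is countable; it contains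
  the sequence, and passing from one set to the next makes it closed under products.
\<close>

lemma infinite_countable_subgroup:
  assumes "infinite (carrier G)"
  obtains B where "subgroup B G" "countable B" "infinite B"
proof -
  obtain e :: "nat \<Rightarrow> 'a" where e: "inj e" "range e \<subseteq> carrier G"
    using infinite_countable_subset[OF assms] by blast
  show thesis
  proof
    show "subgroup (\<Union>n. doubling_sets G e n) G"
      using subgroup_Union_doubling_sets e by blast
    show "countable (\<Union>n. doubling_sets G e n)"
      by (simp add: countable_finite finite_doubling_sets)
    show "infinite (\<Union>n. doubling_sets G e n)"
      using e range_subset_Union_doubling_sets finite_subset range_inj_infinite by metis
  qed
qed

end

text \<open>
  The doubling sets of an enumeration of the image are finite, so none of them is the whole image.
  Conjugate elements of the domain have the same image in an abelian group; hence the preimages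
  of the doubling sets are closed under conjugation.
\<close>

lemma (in group_hom) unbounded_if_countable_infinite_comm_image:
  assumes surj: "h ` carrier G = carrier H" and "comm_group H"
    and "countable (carrier H)" "infinite (carrier H)"
  shows "unbounded_group G"
proof -
  interpret H: comm_group H by fact
  define e where "e = from_nat_into (carrier H)"
  have e: "range e = carrier H"
    unfolding e_def using assms by (intro range_from_nat_into) auto
  then have e_closed: "range e \<subseteq> carrier H" by simp
  define S where "S n = {x \<in> carrier G. h x \<in> doubling_sets H e n}" for n
  show ?thesis
  proof (rule G.unbounded_group_if_filtration)
    show "S n \<subseteq> S (Suc n)" for n
      using H.doubling_sets_Suc[OF e_closed] by (auto simp: S_def simp del: doubling_sets.simps)
    show "carrier G \<subseteq> (\<Union>n. S n)"
      using H.range_subset_Union_doubling_sets[OF e_closed] surj unfolding e S_def by blast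
    show "\<not> carrier G \<subseteq> S n" for n
    proof
      assume "carrier G \<subseteq> S n"
      then have "carrier H \<subseteq> doubling_sets H e n" unfolding surj[symmetric] S_def by blast
      then show False using assms H.finite_doubling_sets finite_subset by blast
    qed
    show "inv x \<in> S n" if "x \<in> carrier G" "x \<in> S n" for n x
      using that H.doubling_sets_inv[OF e_closed] by (simp add: S_def)
    show "x \<otimes> y \<in> S (Suc n)"
      if "x \<in> carrier G" "y \<in> carrier G" "x \<in> S n" "y \<in> S n" for n x y
      using that H.doubling_sets_mult by (simp add: S_def del: doubling_sets.simps)
    show "g \<otimes> x \<otimes> inv g \<in> S n" if "x \<in> carrier G" "g \<in> carrier G" "x \<in> S n" for n x g
    proof -
      have "h (g \<otimes> x \<otimes> inv g) = h x"
        using that by (simp add: H.m_comm[of "h g" "h x"] H.m_assoc)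
      then show ?thesis using that by (simp add: S_def)
    qed
  qed
qed

section \<open>Essential extensions of countable abelian groups\<close>

text \<open>Every nonempty fibre is a coset of the kernel.\<close>

lemma (in group_hom) countable_vimage_if_countable_kernel:
  assumes "countable (kernel G H h)" "countable T"
  shows "countable {x \<in> carrier G. h x \<in> T}"
proof -
  have fibre: "countable {x \<in> carrier G. h x = t}" for t
  proof (cases "\<exists>a\<in>carrier G. h a = t")
    case True
    then obtain a where a: "a \<in> carrier G" "h a = t" by blast
    have "{x \<in> carrier G. h x = t} \<subseteq> (\<otimes>) a ` kernel G H h"
    proof
      fix x assume x: "x \<in> {x \<in> carrier G. h x = t}"
      then have "inv a \<otimes> x \<in> kernel G H h" using a by (auto simp: kernel_def)
      moreover have "x = a \<otimes> (inv a \<otimes> x)" using a x by (simp add: G.m_assoc[symmetric])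
      ultimately show "x \<in> (\<otimes>) a ` kernel G H h" by blast
    qed
    then show ?thesis using assms(1) by (meson countable_image countable_subset)
  next
    case False
    then have "{x \<in> carrier G. h x = t} = {}" by blast
    then show ?thesis by (simp only: countable_empty)
  qed
  have "{x \<in> carrier G. h x \<in> T} = (\<Union>t\<in>T. {x \<in> carrier G. h x = t})" by blast
  then show ?thesis using assms fibre by simp
qed

context comm_group
begin

text \<open>
  Raising to the \<open>n\<close>-th power is an endomorphism of an abelian group, with the \<open>n\<close>-torsion as kernel.
\<close>

lemma countable_pow_vimage:
  fixes n :: nat
  assumes "countable {x \<in> carrier G. x [^] n = \<one>}" "countable T"
  shows "countable {x \<in> carrier G. x [^] n \<in> T}"
proof -
  interpret pow: group_hom G G "\<lambda>x. x [^] n"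
    by unfold_locales (auto simp: hom_def pow_mult_distrib m_comm)
  show ?thesis
    using pow.countable_vimage_if_countable_kernel assms by (simp add: kernel_def)
qed

text \<open>
  If \<open>n = p m\<close>, then the \<open>n\<close>-torsion is the preimage of the \<open>m\<close>-torsion under the \<open>p\<close>-th power map,
  so the claim follows by splitting off one prime at a time.
\<close>

lemma countable_torsion:
  fixes n :: nat
  assumes prime: "\<And>p::nat. Factorial_Ring.prime p \<Longrightarrow> countable {x \<in> carrier G. x [^] p = \<one>}" and "n > 0"
  shows "countable {x \<in> carrier G. x [^] n = \<one>}"
  using \<open>n > 0\<close>
proof (induction n rule: less_induct)
  case (less n)
  show ?case
  proof (cases "n = 1")
    case True
    then have "{x \<in> carrier G. x [^] n = \<one>} \<subseteq> {\<one>}" by auto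
    then show ?thesis by (rule countable_subset) simp
  next
    case False
    then obtain p where p: "Factorial_Ring.prime p" "p dvd n" using prime_factor_nat by blast
    then obtain m where m: "n = p * m" by blast
    have "p > 1" using p prime_gt_1_nat by blast
    then have "m < n" "m > 0" using less.prems m by auto
    then have "countable {x \<in> carrier G. x [^] m = \<one>}" using less.IH by blast
    then have "countable {x \<in> carrier G. x [^] p \<in> {x \<in> carrier G. x [^] m = \<one>}}"
      using countable_pow_vimage prime p by blast
    moreover have "{x \<in> carrier G. x [^] p \<in> {x \<in> carrier G. x [^] m = \<one>}}
        = {x \<in> carrier G. x [^] n = \<one>}"
      by (auto simp: m nat_pow_pow)
    ultimately show ?thesis by simp
  qed
qed

text \<open>
  The hypothesis says that \<open>B\<close> is an essential subgroup. If \<open>x\<close> has prime order \<open>p\<close> and \<open>x\<^sup>n\<close> is a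
  nontrivial element of \<open>B\<close>, then \<open>n\<close> is invertible modulo \<open>p\<close>, so \<open>x\<close> is itself a power of \<open>x\<^sup>n\<close> and
  lies in \<open>B\<close>. Thus the \<open>p\<close>-torsion is countable for each prime \<open>p\<close>, hence so is the \<open>n\<close>-torsion for each
  \<open>n > 0\<close>, and the group is the union over \<open>n > 0\<close> of the countable sets of \<open>n\<close>-th roots of elements
  of \<open>B\<close>.
\<close>

lemma countable_if_essential_countable_subgroup:
  assumes B: "subgroup B G" "countable B"
    and ess: "\<And>x. \<lbrakk>x \<in> carrier G; x \<noteq> \<one>\<rbrakk> \<Longrightarrow> \<exists>n::nat. x [^] n \<in> B - {\<one>}"
  shows "countable (carrier G)"
proof -
  interpret B: subgroup B G by fact
  have "countable {x \<in> carrier G. x [^] p = \<one>}" if p: "Factorial_Ring.prime p" for p :: nat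
  proof -
    have "x \<in> B" if x: "x \<in> carrier G" "x [^] p = \<one>" for x
    proof (cases "x = \<one>")
      case False
      then obtain n :: nat where n: "x [^] n \<in> B" "x [^] n \<noteq> \<one>" using ess x by blast
      have "\<not> p dvd n"
        using n x by (auto simp: nat_pow_pow[symmetric])
      then have "coprime n p"
        using p prime_imp_coprime coprime_commute by blast
      then obtain u where "[n * u = Suc 0] (mod p)" using cong_solve_coprime_nat by blast
      moreover have "p > 1" using p prime_gt_1_nat by blast
      ultimately have "n * u = p * (n * u div p) + 1"
        by (metis One_nat_def cong_def mod_less mult_div_mod_eq)
      then have "(x [^] n) [^] u = x [^] (p * (n * u div p) + 1)"
        using x by (simp add: nat_pow_pow)
      also have "\<dots> = x"
        using x by (simp add: nat_pow_mult[symmetric] nat_pow_pow[symmetric])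
      finally show ?thesis
        using subgroup_int_pow_closed[OF B(1) n(1), of "int u"] by (simp add: int_pow_int)
    qed simp
    then have "{x \<in> carrier G. x [^] p = \<one>} \<subseteq> B" by blast
    then show ?thesis using B(2) by (rule countable_subset)
  qed
  then have "countable {x \<in> carrier G. x [^] n = \<one>}" if "n > 0" for n :: nat
    using that countable_torsion by blast
  then have "countable {x \<in> carrier G. x [^] n \<in> B}" if "n > 0" for n :: nat
    using that countable_pow_vimage B by blast
  then have "countable (\<Union>n\<in>{0<..}. {x \<in> carrier G. x [^] (n::nat) \<in> B})"
    by (intro countable_UN) auto
  moreover have "carrier G \<subseteq> (\<Union>n\<in>{0<..}. {x \<in> carrier G. x [^] (n::nat) \<in> B})"
  proof
    fix x assume x: "x \<in> carrier G"
    have "\<exists>n>0. x [^] (n::nat) \<in> B"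
    proof (cases "x = \<one>")
      case True
      then show ?thesis by auto
    next
      case False
      then obtain n :: nat where n: "x [^] n \<in> B" "x [^] n \<noteq> \<one>" using ess x by blast
      then have "n > 0" by (cases n) auto
      then show ?thesis using n by blast
    qed
    then show "x \<in> (\<Union>n\<in>{0<..}. {x \<in> carrier G. x [^] (n::nat) \<in> B})" using x by auto
  qed
  ultimately show ?thesis by (meson countable_subset)
qed

section \<open>Countably infinite quotients\<close>

lemma maximal_disjoint_subgroup:
  assumes "subgroup B G"
  obtains K where "subgroup K G" "K \<inter> B = {\<one>}"
    "\<forall>K'. subgroup K' G \<and> K' \<inter> B = {\<one>} \<and> K \<subseteq> K' \<longrightarrow> K' = K"
proof -
  define \<A> where "\<A> = {K. subgroup K G \<and> K \<inter> B = {\<one>}}"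
  have "\<exists>K\<in>\<A>. \<forall>K'\<in>\<A>. K \<subseteq> K' \<longrightarrow> K' = K"
  proof (rule subset_Zorn_nonempty)
    have "{\<one>} \<in> \<A>"
      using assms triv_subgroup subgroup.one_closed by (auto simp: \<A>_def)
    then show "\<A> \<noteq> {}" by blast
    fix \<C> assume ne: "\<C> \<noteq> {}" and chain: "subset.chain \<A> \<C>"
    have sub: "subgroup K G" "K \<inter> B = {\<one>}" if "K \<in> \<C>" for K
      using chain that by (auto simp: subset_chain_def \<A>_def)
    have "subgroup (\<Union>\<C>) G"
    proof (rule subgroupI)
      fix x y assume "x \<in> \<Union>\<C>" "y \<in> \<Union>\<C>"
      then obtain K where K: "K \<in> \<C>" "x \<in> K" "y \<in> K"
        using chain unfolding subset_chain_def by blast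
      then show "x \<otimes> y \<in> \<Union>\<C>" using subgroup.m_closed[OF sub(1)[OF K(1)]] by blast
    next
      show "\<Union>\<C> \<noteq> {}" using ne sub subgroup.one_closed by blast
    qed (use sub in \<open>blast dest: subgroup.subset subgroup.m_inv_closed\<close>)+
    then show "\<Union>\<C> \<in> \<A>" using ne sub by (auto simp: \<A>_def)
  qed
  then show thesis using that by (auto simp: \<A>_def)
qed

text \<open>
  By maximality, the subgroup generated by \<open>K\<close> and \<open>x\<close> meets \<open>B\<close> nontrivially. This puts an integer
  power of \<open>x\<close> into a coset \<open>k b\<close>; a negative exponent is made positive by inverting both sides.
  In the quotient by \<open>K\<close> the conclusion says that the image of \<open>B\<close> is essential.
\<close>

lemma pow_in_coset_if_maximal_disjoint:
  assumes B: "subgroup B G" and K: "subgroup K G" "K \<inter> B = {\<one>}"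
    and max: "\<forall>K'. subgroup K' G \<and> K' \<inter> B = {\<one>} \<and> K \<subseteq> K' \<longrightarrow> K' = K"
    and x: "x \<in> carrier G" "x \<notin> K"
  obtains n :: nat and k b where "k \<in> K" "b \<in> B - {\<one>}" "x [^] n = k \<otimes> b"
proof -
  interpret B: subgroup B G by fact
  interpret K: subgroup K G by fact
  define K' where "K' = K <#> generate G {x}"
  have sub: "subgroup K' G"
    unfolding K'_def using K x by (intro mult_subgroups generate_is_subgroup) auto
  have K'_I: "k \<otimes> y \<in> K'" if "k \<in> K" "y \<in> generate G {x}" for k y
    using that unfolding K'_def set_mult_def by blast
  have "k \<in> K'" if "k \<in> K" for k
    using K'_I[OF that generate.one] that by simp
  moreover have "x \<in> K'"
    using K'_I[OF K.one_closed generate.incl[of x]] x by simp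
  ultimately have "K' \<inter> B \<noteq> {\<one>}" using max sub x by blast
  then obtain b where b: "b \<in> K'" "b \<in> B" "b \<noteq> \<one>"
    using subgroup.one_closed[OF sub] B.one_closed by blast
  then obtain k and i :: int where k: "k \<in> K" and b_eq: "b = k \<otimes> x [^] i"
    unfolding K'_def set_mult_def generate_pow[OF x(1)] by auto
  have kc: "k \<in> carrier G" using k by simp
  have xi: "x [^] i = inv k \<otimes> b"
    using kc x unfolding b_eq by (simp add: m_assoc[symmetric])
  show thesis
  proof (cases "i \<ge> 0")
    case True
    then have "x [^] nat i = inv k \<otimes> b" using xi by (metis int_pow_int nat_0_le)
    then show thesis using that k b by blast
  next
    case False
    then have "x [^] nat (- i) = inv (inv k \<otimes> b)"
      using xi x by (metis int_pow_int int_pow_neg le_minus_iff linear minus_zero nat_0_le)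
    also have "\<dots> = k \<otimes> inv b"
      using kc b by (simp add: inv_mult)
    finally show thesis
      using that[of k "inv b" "nat (- i)"] k b by (metis B.m_inv_closed B.mem_carrier DiffI inv_eq_1_iff singletonD)
  qed
qed

text \<open>
  The subgroup \<open>K\<close> has to be small enough to keep a countably infinite subgroup \<open>B\<close> intact, and large
  enough for nothing independent of \<open>B\<close> to survive. A subgroup maximal among those meeting \<open>B\<close>
  trivially achieves both.
\<close>

lemma countable_infinite_quotient:
  assumes "infinite (carrier G)"
  obtains K where "subgroup K G" "countable (carrier (G Mod K))" "infinite (carrier (G Mod K))"
proof -
  obtain B where B: "subgroup B G" "countable B" "infinite B"
    using infinite_countable_subgroup[OF assms] .
  obtain K where K: "subgroup K G" "K \<inter> B = {\<one>}"
    and max: "\<forall>K'. subgroup K' G \<and> K' \<inter> B = {\<one>} \<and> K \<subseteq> K' \<longrightarrow> K' = K"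
    using maximal_disjoint_subgroup[OF B(1)] by blast
  interpret B: subgroup B G by fact
  interpret K: normal K G using subgroup_imp_normal[OF K(1)] .
  let ?Q = "G Mod K"
  interpret Q: comm_group ?Q using abelian_FactGroup[OF K(1)] .
  interpret \<pi>: group_hom G ?Q "\<lambda>x. K #> x"
    using K.r_coset_hom_Mod by unfold_locales
  have ker: "K #> x = \<one>\<^bsub>?Q\<^esub> \<longleftrightarrow> x \<in> K" if "x \<in> carrier G" for x
    using coset_join1[OF _ that K(1)] coset_join2[OF that K(1)] unfolding one_FactGroup by blast
  have surj: "(\<lambda>x. K #> x) ` carrier G = carrier ?Q" by (simp add: carrier_FactGroup)
  let ?B = "(\<lambda>x. K #> x) ` B"
  have inj: "inj_on (\<lambda>x. K #> x) B"
  proof (rule inj_onI)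
    fix x y assume xy: "x \<in> B" "y \<in> B" "K #> x = K #> y"
    have "K #> (x \<otimes> inv y) = \<one>\<^bsub>?Q\<^esub>" 
      using \<pi>.hom_mult[of x "inv y"] \<pi>.hom_inv[of y] Q.r_inv[of "K #> y"] \<pi>.hom_closed[of y] xy
      by (simp del: mult_FactGroup one_FactGroup)
    then have "x \<otimes> inv y \<in> K" using ker[of "x \<otimes> inv y"] xy(1,2)
      by (metis B.mem_carrier inv_closed m_closed)
    then have "x \<otimes> inv y \<in> K \<inter> B" using xy by simp
    then show "x = y" using K(2) xy by (metis B.mem_carrier inv_closed inv_equality inv_inv singletonD)
  qed
  have "countable (carrier ?Q)"
  proof (rule Q.countable_if_essential_countable_subgroup)
    show "subgroup ?B ?Q" using \<pi>.subgroup_img_is_subgroup[OF B(1)] .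
    show "countable ?B" using B by simp
    fix y assume y: "y \<in> carrier ?Q" "y \<noteq> \<one>\<^bsub>?Q\<^esub>"
    then obtain x where x: "x \<in> carrier G" "y = K #> x" using surj by blast
    then have "x \<notin> K" using y ker by blast
    then obtain n :: nat and k b where nkb: "k \<in> K" "b \<in> B - {\<one>}" "x [^] n = k \<otimes> b"
      using pow_in_coset_if_maximal_disjoint[OF B(1) K max x(1)] by metis
    have "y [^]\<^bsub>?Q\<^esub> n = K #> (x [^] n)" using x K.FactGroup_pow by simp
    also have "\<dots> = K #> b"
      using nkb x \<pi>.hom_mult[of k b] ker[of k] \<pi>.hom_closed[of b] Q.l_one by auto
    finally have "y [^]\<^bsub>?Q\<^esub> n = K #> b" .
    moreover have "K #> b \<noteq> \<one>\<^bsub>?Q\<^esub>" using nkb ker K(2) by auto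
    ultimately show "\<exists>n::nat. y [^]\<^bsub>?Q\<^esub> n \<in> ?B - {\<one>\<^bsub>?Q\<^esub>}" using nkb by auto
  qed
  moreover have "infinite (carrier ?Q)"
  proof -
    have "infinite ?B" using B inj finite_imageD by blast
    moreover have "?B \<subseteq> carrier ?Q" using surj B.subset by blast
    ultimately show ?thesis using finite_subset by blast
  qed
  ultimately show thesis using that K by blast
qed

end

theorem proposition1p3:
  fixes G :: "('a, 'b) monoid_scheme"
  assumes "group G"
    and "infinite (carrier (G Mod derived G (carrier G)))"
  shows "unbounded_group G"
proof -
  interpret group G by fact
  let ?D = "derived G (carrier G)"
  interpret D: normal ?D G using derived_is_normal[OF normal_self] .
  interpret A: comm_group "G Mod ?D" using derived_quot_is_comm_group .
  obtain K where K: "subgroup K (G Mod ?D)"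
    and Q: "countable (carrier (G Mod ?D Mod K))" "infinite (carrier (G Mod ?D Mod K))"
    using A.countable_infinite_quotient[OF assms(2)] .
  interpret K: normal K "G Mod ?D" using A.subgroup_imp_normal[OF K] .
  interpret Q: comm_group "G Mod ?D Mod K" using A.abelian_FactGroup[OF K] .
  let ?\<pi> = "r_coset (G Mod ?D) K \<circ> r_coset G ?D"
  have "?\<pi> \<in> hom G (G Mod ?D Mod K)"
    using D.r_coset_hom_Mod K.r_coset_hom_Mod by (rule Group.hom_compose)
  then interpret \<pi>: group_hom G "G Mod ?D Mod K" ?\<pi>
    by unfold_locales
  have "?\<pi> ` carrier G = carrier (G Mod ?D Mod K)"
    by (simp add: carrier_FactGroup image_comp)
  then show ?thesis
    using \<pi>.unbounded_if_countable_infinite_comm_image Q.comm_group_axioms Q by blast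
qed

end
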